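(* Let $m$ and $b$ be positive integers and let $G$ be the one-paired circulant graph $G=C(mb;1,b)$. Then $G$ is Buchsbaum. Furthermore, for each of the three properties "vertex decomposable", "shellable", "Cohen-Macaulay", the graph $G$ has that property if and only if $m=1$.
   Context: For an integer $n\ge 1$ and a set $S\subseteq\{1,\ldots,\lfloor n/2\rfloor\}$, the circulant graph $C_n(S)$ has vertex set $\{0,1,\ldots,n-1\}$, and distinct $x,y$ are adjacent if and only if $|x-y|\in S$ or $n-|x-y|\in S$. For positive integers $a,b$ with $ab\mid n$, the one-paired circulant $C(n;a,b)$ is the circulant graph $C_n(S)$ with $S=\{d\in\{1,\ldots,\lfloor n/2\rfloor\} : a\mid d \text{ and } ab\nmid d\}$. The independence complex $\mathrm{Ind}(G)$ of a finite simple graph $G$ is the simplicial complex of all independent sets of $G$. A simplicial complex is pure if all its facets (maximal faces) have the same dimension. For a simplicial complex $\Delta$ and a face $F$: $\mathrm{link}_\Delta(F)=\{H\in\Delta : F\cap H=\emptyset,\ F\cup H\in\Delta\}$ and $\mathrm{del}_\Delta(F)=\{H\in\Delta : F\not\subseteq H\}$; for a vertex $x$ write $x$ instead of $\{x\}$. Also $\dim F=|F|-1$, and $\dim\Delta$ is the maximum dimension of a face of $\Delta$. Fix a field $k$. A pure simplicial complex $\Delta$ is: - vertex decomposable if $\Delta$ is a simplex (its whole vertex set is its unique facet), or there is a vertex $x$ such that $\mathrm{link}_\Delta(x)$ and $\mathrm{del}_\Delta(x)$ are (pure and) vertex decomposable; - shellable if its facets can be ordered $F_1,\ldots,F_t$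 so that for all $1\le j<i\le t$ there are $x\in F_i\setminus F_j$ and $l\in\{1,\ldots,i-1\}$ with $F_i\setminus F_l=\{x\}$; - Cohen-Macaulay if for all $F\in\Delta$, $\tilde H_i(\mathrm{link}_\Delta(F),k)=0$ for all $i<\dim \mathrm{link}_\Delta(F)$ (reduced simplicial homology); - Buchsbaum if $\mathrm{link}_\Delta(x)$ is Cohen-Macaulay for every vertex $x$. A graph $G$ is said to have one of these properties if $\mathrm{Ind}(G)$ is pure and has it.
   Formalization: The three equivalences with m=1 are stated only for b ≥ 2: for b=1 and m ≥ 2 the graph has no edges, its independence complex is a simplex, and all three properties hold although m ≠ 1. The Buchsbaum claim is kept for all m, b ≥ 1. *)

theory Defs
  imports "HOL-Algebra.Elementary_Groups" "HOL-Library.Poly_Mapping"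
begin

text \<open>A simple graph is a vertex set with a set of two-element edges.\<close>

record 'a simple_graph =
  verts :: "'a set"
  edges :: "'a set set"

definition circulant :: "nat \<Rightarrow> nat set \<Rightarrow> nat simple_graph" where
  "circulant n S =
     \<lparr>verts = {0..<n},
      edges = {{x, y} | x y. x < n \<and> y < n \<and> x \<noteq> y \<and>
        (nat \<bar>int x - int y\<bar> \<in> S \<or> n - nat \<bar>int x - int y\<bar> \<in> S)}\<rparr>"

definition one_paired_circulant :: "nat \<Rightarrow> nat \<Rightarrow> nat \<Rightarrow> nat simple_graph" where
  "one_paired_circulant n a b =
     circulant n {d \<in> {1..n div 2}. a dvd d \<and> \<not> a * b dvd d}"

definition Ind :: "'a simple_graph \<Rightarrow> 'a set set" where
  "Ind G = {W. W \<subseteq> verts G \<and> (\<forall>e \<in> edges G. \<not> e \<subseteq> W)}"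


text \<open>
  A simplicial complex is the set \<open>\<Delta>\<close> of its faces (a finite, nonempty, downward closed family
  of finite sets, containing the empty face). Its vertices are the \<open>x\<close> with \<open>{x} \<in> \<Delta>\<close>, so
  its vertex set is \<open>\<Union>\<Delta>\<close>. In particular \<open>{{}}\<close> is a simplex, of dimension \<open>-1\<close>.
\<close>

definition face_dim :: "'a set \<Rightarrow> int" where
  "face_dim F = int (card F) - 1"

definition complex_dim :: "'a set set \<Rightarrow> int" where
  "complex_dim \<Delta> = Max (face_dim ` \<Delta>)"

definition facets :: "'a set set \<Rightarrow> 'a set set" where
  "facets \<Delta> = {F \<in> \<Delta>. \<forall>H \<in> \<Delta>. F \<subseteq> H \<longrightarrow> H = F}"

definition pure_complex :: "'a set set \<Rightarrow> bool" where
  "pure_complex \<Delta> \<longleftrightarrow> (\<forall>F \<in> facets \<Delta>. \<forall>H \<in> facets \<Delta>. face_dim F = face_dim H)"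

definition link :: "'a set set \<Rightarrow> 'a set \<Rightarrow> 'a set set" where
  "link \<Delta> F = {H \<in> \<Delta>. F \<inter> H = {} \<and> F \<union> H \<in> \<Delta>}"

definition del :: "'a set set \<Rightarrow> 'a set \<Rightarrow> 'a set set" where
  "del \<Delta> F = {H \<in> \<Delta>. \<not> F \<subseteq> H}"

inductive vertex_decomposable :: "'a set set \<Rightarrow> bool" where
  simplex: "pure_complex \<Delta> \<Longrightarrow> facets \<Delta> = {\<Union>\<Delta>} \<Longrightarrow> vertex_decomposable \<Delta>"
| vertex: "pure_complex \<Delta> \<Longrightarrow> {x} \<in> \<Delta> \<Longrightarrow>
    vertex_decomposable (link \<Delta> {x}) \<Longrightarrow> vertex_decomposable (del \<Delta> {x}) \<Longrightarrow>
    vertex_decomposable \<Delta>"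

definition shellable :: "'a set set \<Rightarrow> bool" where
  "shellable \<Delta> \<longleftrightarrow> pure_complex \<Delta> \<and>
     (\<exists>Fs. distinct Fs \<and> set Fs = facets \<Delta> \<and>
        (\<forall>i < length Fs. \<forall>j < i.
           \<exists>x \<in> Fs ! i - Fs ! j. \<exists>l < i. Fs ! i - Fs ! l = {x}))"


text \<open>
  Reduced simplicial homology with coefficients in \<open>'k\<close>. The free \<open>'k\<close>-vector space on faces
  consists of finitely supported functions, and each face is oriented by the order on the vertices:
  the boundary of \<open>[v\<^sub>0 < \<dots> < v\<^sub>p]\<close> is the sum of \<open>(-1)\<^sup>j [v\<^sub>0, \<dots>, omit v\<^sub>j, \<dots>, v\<^sub>p]\<close>,
  where \<open>j\<close> is the number of vertices below \<open>v\<^sub>j\<close>. The complex is augmented: in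
  degree \<open>-1\<close> it is spanned by the empty face.
\<close>

definition chains :: "'a set set \<Rightarrow> int \<Rightarrow> ('a set \<Rightarrow>\<^sub>0 'k::field) set" where
  "chains \<Delta> i = {c. Poly_Mapping.keys c \<subseteq> {F \<in> \<Delta>. face_dim F = i}}"

definition boundary :: "('a::linorder set \<Rightarrow>\<^sub>0 'k::field) \<Rightarrow> ('a set \<Rightarrow>\<^sub>0 'k)" where
  "boundary c =
     (\<Sum>F \<in> Poly_Mapping.keys c. \<Sum>v \<in> F.
        Poly_Mapping.single (F - {v})
          ((- 1) ^ card {u \<in> F. u < v} * Poly_Mapping.lookup c F))"

definition cycle_group :: "'a::linorder set set \<Rightarrow> int \<Rightarrow> ('a set \<Rightarrow>\<^sub>0 'k::field) monoid" where
  "cycle_group \<Delta> i =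
     \<lparr>carrier = {c \<in> chains \<Delta> i. boundary c = 0}, mult = (+), one = 0\<rparr>"

text \<open>
  Only the additive group of the homology vector space is recorded; this suffices to say
  that it is zero.
\<close>

definition reduced_homology ::
    "'a::linorder set set \<Rightarrow> int \<Rightarrow> ('a set \<Rightarrow>\<^sub>0 'k::field) set monoid" where
  "reduced_homology \<Delta> i = cycle_group \<Delta> i Mod (boundary ` chains \<Delta> (i + 1))"

definition cohen_macaulay :: "'k::field itself \<Rightarrow> 'a::linorder set set \<Rightarrow> bool" where
  "cohen_macaulay k \<Delta> \<longleftrightarrow> pure_complex \<Delta> \<and>
     (\<forall>F \<in> \<Delta>. \<forall>i < complex_dim (link \<Delta> F).
        trivial_group (reduced_homology (link \<Delta> F) i :: ('a set \<Rightarrow>\<^sub>0 'k) set monoid))"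

definition buchsbaum :: "'k::field itself \<Rightarrow> 'a::linorder set set \<Rightarrow> bool" where
  "buchsbaum k \<Delta> \<longleftrightarrow> pure_complex \<Delta> \<and>
     (\<forall>x. {x} \<in> \<Delta> \<longrightarrow> cohen_macaulay k (link \<Delta> {x}))"

end

theory Submission
  imports Defs HOL.Modules
begin

text \<open>
  Since \<open>b\<close> divides \<open>n = mb\<close>, it divides a distance \<open>d\<close> if and only if it divides \<open>n - d\<close>. So two
  vertices of \<open>C(mb;1,b)\<close> are adjacent exactly when they are incongruent modulo \<open>b\<close>: the graph is
  the complete multipartite graph whose parts are the \<open>b\<close> residue classes, each of size \<open>m\<close>, and
  its independence complex is the disjoint union of \<open>b\<close> simplices on \<open>m\<close> vertices each
  (\<open>Ind_one_paired_circulant\<close>, \<open>card_residue_class\<close>). The rest concerns such disjoint unions.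

  The link of a vertex only sees the simplex through that vertex and is the simplex on the other
  \<open>m - 1\<close> vertices. Simplices are Cohen-Macaulay: the links in a simplex are simplices, and a
  nonempty simplex is a cone, so coning with its least vertex exhibits every cycle as a boundary
  (\<open>boundary_cone_chain\<close>, \<open>cohen_macaulay_Pow\<close>). This gives the Buchsbaum property.

  If \<open>m = 1\<close>, the complex is a finite nonempty set of points: any order of the points is a shelling,
  removing the points one by one is a vertex decomposition, and the only condition on homology
  below dimension \<open>0\<close> is that some point bounds the empty face.

  If \<open>m \<ge> 2\<close> and there are at least two simplices, each property fails for its own elementary
  reason. In a shelling, the second facet would be disjoint from the first and yet exceed it by a
  single vertex, although it has \<open>m\<close> of them. Deleting a vertex of one simplex leaves a facet with
  \<open>m - 1\<close> vertices next to one with \<open>m\<close>, so no deletion is pure. Finally the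
  complex is disconnected of positive dimension, so its reduced homology in degree \<open>0\<close>, which would
  have to vanish, does not.
\<close>


section \<open>Additive maps on chains\<close>

text \<open>
  The boundary and the cone operator are both given by a formula on single faces, summed over the
  support of a chain. Additivity is not immediate because supports can shrink under addition;
  it holds since absent faces contribute \<open>0\<close>, which allows all sums to range over the union of the two
  supports.
\<close>

lemma additive_extension:
  fixes \<phi> :: "'b \<Rightarrow> 'k::ab_group_add \<Rightarrow> 'c::ab_group_add"
  assumes "\<And>F. additive (\<phi> F)"
  shows "additive (\<lambda>c. \<Sum>F \<in> Poly_Mapping.keys c. \<phi> F (Poly_Mapping.lookup c F))"
proof
  fix c d :: "'b \<Rightarrow>\<^sub>0 'k"
  let ?K = "Poly_Mapping.keys c \<union> Poly_Mapping.keys d"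
  have zero: "\<phi> F 0 = 0" for F
    by (rule additive.zero) (rule assms)
  have extend: "(\<Sum>F \<in> Poly_Mapping.keys e. \<phi> F (Poly_Mapping.lookup e F)) =
      (\<Sum>F \<in> ?K. \<phi> F (Poly_Mapping.lookup e F))"
    if "Poly_Mapping.keys e \<subseteq> ?K" for e
    by (rule sum.mono_neutral_left) (use that in \<open>auto simp: zero in_keys_iff\<close>)
  have "(\<Sum>F \<in> ?K. \<phi> F (Poly_Mapping.lookup (c + d) F)) =
      (\<Sum>F \<in> ?K. \<phi> F (Poly_Mapping.lookup c F)) + (\<Sum>F \<in> ?K. \<phi> F (Poly_Mapping.lookup d F))"
    by (simp add: lookup_add additive.add[OF assms] sum.distrib)
  then show "(\<Sum>F \<in> Poly_Mapping.keys (c + d). \<phi> F (Poly_Mapping.lookup (c + d) F)) =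
      (\<Sum>F \<in> Poly_Mapping.keys c. \<phi> F (Poly_Mapping.lookup c F)) +
      (\<Sum>F \<in> Poly_Mapping.keys d. \<phi> F (Poly_Mapping.lookup d F))"
    using extend[of "c + d"] extend[of c] extend[of d] Poly_Mapping.keys_add[of c d] by auto
qed

lemma additive_comp:
  assumes "additive f" "additive g" shows "additive (\<lambda>x. f (g x))"
  using assms by (simp add: additive_def)

lemma additive_sum_maps:
  assumes "\<And>i. i \<in> I \<Longrightarrow> additive (f i)" shows "additive (\<lambda>x. \<Sum>i \<in> I. f i x)"
  using assms by (simp add: additive_def sum.distrib)

lemma additive_single_mult: "additive (\<lambda>a. Poly_Mapping.single F (s * a :: 'k::field))"
  by (simp add: additive_def distrib_left single_add)

text \<open>
  Applied to the difference of its two sides, this reduces an identity between chain operators to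
  chains supported on a single face.
\<close>

lemma additive_eq_zeroI:
  fixes f :: "('b \<Rightarrow>\<^sub>0 'k::ab_group_add) \<Rightarrow> 'c::ab_group_add"
  assumes "additive f"
    and "\<And>F a. F \<in> Poly_Mapping.keys c \<Longrightarrow> f (Poly_Mapping.single F a) = 0"
  shows "f c = 0"
proof -
  have "c = (\<Sum>F \<in> Poly_Mapping.keys c. Poly_Mapping.single F (Poly_Mapping.lookup c F))"
    by (rule poly_mapping_eqI)
      (auto simp: lookup_sum lookup_single when_def in_keys_iff)
  then have "f c = (\<Sum>F \<in> Poly_Mapping.keys c. f (Poly_Mapping.single F (Poly_Mapping.lookup c F)))"
    using additive.sum[OF assms(1)] by metis
  also have "\<dots> = 0"
    by (simp add: assms(2))
  finally show ?thesis .
qed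


section \<open>The boundary and the cone operator\<close>

lemma additive_boundary: "additive (boundary :: ('a::linorder set \<Rightarrow>\<^sub>0 'k::field) \<Rightarrow> _)"
  unfolding boundary_def
  by (rule additive_extension, rule additive_sum_maps, rule additive_single_mult)

lemma boundary_single:
  "boundary (Poly_Mapping.single F a) =
     (\<Sum>v \<in> F. Poly_Mapping.single (F - {v}) ((- 1) ^ card {u \<in> F. u < v} * a))"
  by (simp add: boundary_def)

text \<open>
  This is the cone operator with apex \<open>v\<close>. Faces that already contain \<open>v\<close> would become degenerate
  and are sent to \<open>0\<close>. No sign is needed as long as \<open>v\<close> lies below all vertices of the faces in
  question, for then it comes first in the orientation.
\<close>

definition cone_chain :: "'a \<Rightarrow> ('a set \<Rightarrow>\<^sub>0 'k::field) \<Rightarrow> ('a set \<Rightarrow>\<^sub>0 'k)" where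
  "cone_chain v c = (\<Sum>F \<in> Poly_Mapping.keys c.
     if v \<in> F then 0 else Poly_Mapping.single (insert v F) (Poly_Mapping.lookup c F))"

lemma additive_cone_chain: "additive (cone_chain v)"
  unfolding cone_chain_def by (rule additive_extension) (simp add: additive_def single_add)

lemma cone_chain_single:
  "cone_chain v (Poly_Mapping.single F a) =
     (if v \<in> F then 0 else Poly_Mapping.single (insert v F) a)"
  by (simp add: cone_chain_def)

text \<open>
  Omitting the apex from the cone gives back \<open>F\<close> with sign \<open>+1\<close>. Omitting another vertex gives the
  cone over a facet of \<open>F\<close>, with the opposite sign to the one in the boundary of \<open>F\<close>, because the
  apex adds one vertex below.
\<close>

lemma boundary_cone_single:
  fixes v :: "'a::linorder" and a :: "'k::field"
  assumes "finite F" "\<forall>u \<in> F. v < u"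
  shows "boundary (Poly_Mapping.single (insert v F) a) =
    Poly_Mapping.single F a - cone_chain v (boundary (Poly_Mapping.single F a))"
proof -
  have v: "v \<notin> F"
    using assms(2) by auto
  have below_v: "{u \<in> insert v F. u < v} = {}"
    using assms(2) by auto
  have sign: "card {w \<in> insert v F. w < u} = Suc (card {w \<in> F. w < u})" if "u \<in> F" for u
  proof -
    have "{w \<in> insert v F. w < u} = insert v {w \<in> F. w < u}"
      using assms(2) that by auto
    then show ?thesis
      using assms(1) v by simp
  qed
  have face: "insert v F - {u} = insert v (F - {u})" if "u \<in> F" for u
    using v that by auto
  have "boundary (Poly_Mapping.single (insert v F) a) = Poly_Mapping.single F a +
      (\<Sum>u \<in> F. Poly_Mapping.single (insert v F - {u})
        ((- 1) ^ card {w \<in> insert v F. w < u} * a))"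
    using assms(1) v by (simp add: boundary_single below_v Diff_insert_absorb
        del: insert_iff insert_Diff_if)
  also have "(\<Sum>u \<in> F. Poly_Mapping.single (insert v F - {u})
        ((- 1) ^ card {w \<in> insert v F. w < u} * a)) =
      - (\<Sum>u \<in> F. Poly_Mapping.single (insert v (F - {u})) ((- 1) ^ card {w \<in> F. w < u} * a))"
    unfolding sum_negf[symmetric]
    by (rule sum.cong) (simp_all add: sign face single_uminus del: insert_iff)
  also have "(\<Sum>u \<in> F. Poly_Mapping.single (insert v (F - {u})) ((- 1) ^ card {w \<in> F. w < u} * a)) =
      cone_chain v (boundary (Poly_Mapping.single F a))"
    using v by (simp add: boundary_single additive.sum[OF additive_cone_chain] cone_chain_single)
  finally show ?thesis
    by simp
qed

lemma boundary_vertex: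
  "boundary (Poly_Mapping.single {v} a :: 'a::linorder set \<Rightarrow>\<^sub>0 'k::field) = Poly_Mapping.single {} a"
  using boundary_cone_single[of "{}" v a]
  by (simp add: boundary_single[of "{}"] additive.zero[OF additive_cone_chain])

text \<open>
  The contracting homotopy of a cone. It also covers the faces through the apex: if \<open>F\<close> is the cone
  over \<open>E\<close>, then the cone operator kills \<open>F\<close>, while coning the boundary of \<open>F\<close> gives \<open>F\<close> back, since
  \<open>E\<close> yields \<open>F\<close> and the other facets of \<open>F\<close> contain the apex.
\<close>

lemma boundary_cone_chain:
  fixes v :: "'a::linorder" and c :: "'a set \<Rightarrow>\<^sub>0 'k::field"
  assumes "\<And>F. F \<in> Poly_Mapping.keys c \<Longrightarrow> finite F \<and> (\<forall>u \<in> F. v \<le> u)"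
  shows "boundary (cone_chain v c) = c - cone_chain v (boundary c)"
proof -
  let ?f = "\<lambda>c :: 'a set \<Rightarrow>\<^sub>0 'k. boundary (cone_chain v c) - (c - cone_chain v (boundary c))"
  have "additive ?f"
    by unfold_locales (simp add: additive.add[OF additive_boundary]
      additive.add[OF additive_cone_chain] algebra_simps)
  moreover have "?f (Poly_Mapping.single F a) = 0" if "F \<in> Poly_Mapping.keys c" for F and a :: 'k
  proof (cases "v \<in> F")
    case False
    then have "\<forall>u \<in> F. v < u"
      using assms[OF that] by (metis order.not_eq_order_implies_strict)
    then show ?thesis
      using False assms[OF that] boundary_cone_single[of F v a] by (simp add: cone_chain_single)
  next
    case True
    let ?E = "F - {v}"
    have E: "finite ?E" "\<forall>u \<in> ?E. v < u" and F: "insert v ?E = F"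
      using True assms[OF that] by (auto simp: order.not_eq_order_implies_strict)
    have idem: "cone_chain v (cone_chain v d) = 0" for d :: "'a set \<Rightarrow>\<^sub>0 'k"
      by (rule additive_eq_zeroI[OF additive_comp[OF additive_cone_chain additive_cone_chain]])
        (simp add: cone_chain_single additive.zero[OF additive_cone_chain])
    have "boundary (Poly_Mapping.single F a) =
        Poly_Mapping.single ?E a - cone_chain v (boundary (Poly_Mapping.single ?E a))"
      using boundary_cone_single[OF E] F by simp
    then have "cone_chain v (boundary (Poly_Mapping.single F a)) = Poly_Mapping.single F a"
      using F by (simp add: additive.diff[OF additive_cone_chain] idem cone_chain_single)
    then show ?thesis
      using True by (simp add: cone_chain_single additive.zero[OF additive_boundary])
  qed
  ultimately have "?f c = 0"
    by (rule additive_eq_zeroI)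
  then show ?thesis
    by simp
qed

lemma keys_boundary:
  assumes "E \<in> Poly_Mapping.keys (boundary c)"
  obtains F v where "F \<in> Poly_Mapping.keys c" "finite F" "v \<in> F" "E = F - {v}"
proof -
  obtain F where F: "F \<in> Poly_Mapping.keys c" and
    E: "E \<in> Poly_Mapping.keys (\<Sum>v \<in> F. Poly_Mapping.single (F - {v})
          ((- 1) ^ card {u \<in> F. u < v} * Poly_Mapping.lookup c F))"
    using subsetD[OF keys_sum assms[unfolded boundary_def]] by blast
  moreover have "finite F"
    using E by (cases "finite F") simp_all
  moreover obtain v where "v \<in> F" "E = F - {v}"
    using subsetD[OF keys_sum E] by (auto split: if_splits)
  ultimately show ?thesis
    using that by blast
qed

lemma keys_cone_chain:
  assumes "E \<in> Poly_Mapping.keys (cone_chain v c)"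
  obtains F where "F \<in> Poly_Mapping.keys c" "v \<notin> F" "E = insert v F"
  using subsetD[OF keys_sum assms[unfolded cone_chain_def]] that by (auto split: if_splits)

text \<open>
  The homotopy replaces the usual cancellation of signs in pairs. The face with least vertex \<open>v\<close>
  added to \<open>F\<close> is a cone over \<open>F\<close>, so its boundary is \<open>F\<close> minus the cone over the boundary of \<open>F\<close>;
  by induction the boundary of \<open>F\<close> is a cycle, and the boundary of the cone over a cycle is that cycle.
\<close>

lemma boundary_boundary_single:
  fixes F :: "'a::linorder set" and a :: "'k::field"
  assumes "finite F"
  shows "boundary (boundary (Poly_Mapping.single F a)) = 0"
  using assms
proof (induction F rule: finite_linorder_min_induct)
  case empty
  then show ?case
    by (simp add: boundary_single additive.zero[OF additive_boundary])
next
  case (insert v F)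
  let ?c = "Poly_Mapping.single F a"
  have "finite E \<and> (\<forall>u \<in> E. v \<le> u)" if "E \<in> Poly_Mapping.keys (boundary ?c)" for E
    using that
  proof (rule keys_boundary)
    fix H w assume "H \<in> Poly_Mapping.keys ?c" and E: "E = H - {w}"
    then have "H = F"
      by (simp split: if_splits)
    then show ?thesis
      using E insert.hyps by (auto intro: less_imp_le)
  qed
  then have cone: "boundary (cone_chain v (boundary ?c)) = boundary ?c"
    by (subst boundary_cone_chain) (simp_all add: insert.IH additive.zero[OF additive_cone_chain])
  have "boundary (Poly_Mapping.single (insert v F) a) = ?c - cone_chain v (boundary ?c)"
    using insert.hyps by (intro boundary_cone_single) auto
  then show ?case
    by (simp only: additive.diff[OF additive_boundary] cone diff_self)
qed

lemma boundary_boundary: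
  fixes c :: "'a::linorder set \<Rightarrow>\<^sub>0 'k::field"
  shows "boundary (boundary c) = 0"
proof (rule additive_eq_zeroI[OF additive_comp[OF additive_boundary additive_boundary]])
  show "boundary (boundary (Poly_Mapping.single F a)) = 0" for F :: "'a set" and a :: 'k
  proof (cases "finite F")
    case True
    then show ?thesis
      by (rule boundary_boundary_single)
  next
    case False
    then show ?thesis
      by (simp add: boundary_single additive.zero[OF additive_boundary])
  qed
qed


section \<open>Vanishing of reduced homology\<close>

lemma zero_in_chains: "0 \<in> chains \<Delta> i"
  by (simp add: chains_def)

lemma chains_add: "c \<in> chains \<Delta> i \<Longrightarrow> d \<in> chains \<Delta> i \<Longrightarrow> c + d \<in> chains \<Delta> i"
  using Poly_Mapping.keys_add[of c d] by (auto simp: chains_def)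

lemma chains_uminus: "c \<in> chains \<Delta> i \<Longrightarrow> - c \<in> chains \<Delta> i"
  by (simp add: chains_def)

lemma boundary_in_chains:
  assumes "\<And>F H. F \<in> \<Delta> \<Longrightarrow> H \<subseteq> F \<Longrightarrow> H \<in> \<Delta>" and "c \<in> chains \<Delta> (i + 1)"
  shows "boundary c \<in> chains \<Delta> i"
proof -
  have "E \<in> \<Delta> \<and> face_dim E = i" if "E \<in> Poly_Mapping.keys (boundary c)" for E
  proof -
    obtain F v where F: "F \<in> Poly_Mapping.keys c" "finite F" "v \<in> F" "E = F - {v}"
      using \<open>E \<in> _\<close> by (rule keys_boundary)
    then have "F \<in> \<Delta>" "face_dim F = i + 1"
      using assms(2) by (auto simp: chains_def)
    moreover have "card F > 0"
      using F by (auto simp: card_gt_0_iff)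
    ultimately show ?thesis
      using F assms(1)[of F E] by (auto simp: face_dim_def)
  qed
  then show ?thesis
    by (auto simp: chains_def)
qed

lemma comm_group_cycle_group: "comm_group (cycle_group \<Delta> i)"
proof (rule comm_groupI)
  fix c assume "c \<in> carrier (cycle_group \<Delta> i)"
  then show "\<exists>d \<in> carrier (cycle_group \<Delta> i). d \<otimes>\<^bsub>cycle_group \<Delta> i\<^esub> c = \<one>\<^bsub>cycle_group \<Delta> i\<^esub>"
    by (intro bexI[of _ "- c"])
      (auto simp: cycle_group_def chains_uminus additive.minus[OF additive_boundary])
qed (auto simp: cycle_group_def zero_in_chains chains_add additive.add[OF additive_boundary]
      additive.zero[OF additive_boundary] add_ac)

text \<open>
  Triviality of the quotient group includes being a group at all, which requires the boundaries to
  form a subgroup of the cycles; this is where \<open>boundary_boundary\<close> enters.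
\<close>

lemma trivial_reduced_homology_iff:
  fixes \<Delta> :: "'a::linorder set set"
  assumes "\<And>F H. F \<in> \<Delta> \<Longrightarrow> H \<subseteq> F \<Longrightarrow> H \<in> \<Delta>"
  shows "trivial_group (reduced_homology \<Delta> i :: ('a set \<Rightarrow>\<^sub>0 'k::field) set monoid) \<longleftrightarrow>
    (\<forall>c \<in> chains \<Delta> i. boundary c = (0 :: 'a set \<Rightarrow>\<^sub>0 'k) \<longrightarrow> c \<in> boundary ` chains \<Delta> (i + 1))"
proof -
  let ?Z = "cycle_group \<Delta> i :: ('a set \<Rightarrow>\<^sub>0 'k) monoid"
  let ?B = "boundary ` chains \<Delta> (i + 1) :: ('a set \<Rightarrow>\<^sub>0 'k) set"
  interpret Z: comm_group ?Z
    by (rule comm_group_cycle_group)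
  have inv: "inv\<^bsub>?Z\<^esub> c = - c" if "c \<in> carrier ?Z" for c
    by (rule Z.inv_equality)
      (use that in \<open>auto simp: cycle_group_def chains_uminus additive.minus[OF additive_boundary]\<close>)
  have BZ: "?B \<subseteq> carrier ?Z"
    by (auto simp: cycle_group_def boundary_boundary boundary_in_chains assms)
  have sub: "subgroup ?B ?Z"
  proof (rule Z.subgroupI)
    show "inv\<^bsub>?Z\<^esub> c \<in> ?B" if c: "c \<in> ?B" for c
    proof -
      obtain d where d: "c = boundary d" "d \<in> chains \<Delta> (i + 1)"
        using c by blast
      moreover have "inv\<^bsub>?Z\<^esub> c = - c"
        using c BZ inv by blast
      ultimately have "inv\<^bsub>?Z\<^esub> c = boundary (- d)"
        by (simp add: additive.minus[OF additive_boundary])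
      then show ?thesis
        using d(2) chains_uminus by blast
    qed
    show "c \<otimes>\<^bsub>?Z\<^esub> d \<in> ?B" if "c \<in> ?B" "d \<in> ?B" for c d
    proof -
      obtain c' d' where "c = boundary c'" "c' \<in> chains \<Delta> (i + 1)"
        "d = boundary d'" "d' \<in> chains \<Delta> (i + 1)"
        using \<open>c \<in> ?B\<close> \<open>d \<in> ?B\<close> by blast
      then have "c \<otimes>\<^bsub>?Z\<^esub> d = boundary (c' + d')" "c' + d' \<in> chains \<Delta> (i + 1)"
        by (simp_all add: cycle_group_def chains_add additive.add[OF additive_boundary])
      then show ?thesis
        by blast
    qed
  qed (use BZ zero_in_chains in blast)+
  then interpret B: normal ?B ?Z
    by (rule Z.subgroup_imp_normal)
  have "trivial_group (?Z Mod ?B) \<longleftrightarrow> carrier (?Z Mod ?B) \<subseteq> {?B}"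
    using group.trivial_group_subset[OF B.factorgroup_is_group] by simp
  also have "\<dots> \<longleftrightarrow> (\<forall>c \<in> carrier ?Z. ?B #>\<^bsub>?Z\<^esub> c = ?B)"
    by (auto simp: carrier_FactGroup)
  also have "\<dots> \<longleftrightarrow> (\<forall>c \<in> carrier ?Z. c \<in> ?B)"
    using Z.coset_join1[OF _ _ sub] Z.coset_join2[OF _ sub] by metis
  finally show ?thesis
    unfolding reduced_homology_def by (auto simp: cycle_group_def)
qed


section \<open>Simplices and sets of points\<close>

lemma facets_Pow: "facets (Pow V) = {V}"
  by (auto simp: facets_def)

lemma pure_Pow: "pure_complex (Pow V)"
  by (simp add: pure_complex_def facets_Pow)

lemma link_Pow: "F \<subseteq> V \<Longrightarrow> link (Pow V) F = Pow (V - F)"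
  by (auto simp: link_def)

lemma complex_dim_Pow:
  assumes "finite V" shows "complex_dim (Pow V) = int (card V) - 1"
  unfolding complex_dim_def
proof (rule Max_eqI)
  show "y \<le> int (card V) - 1" if "y \<in> face_dim ` Pow V" for y
  proof -
    obtain F where "F \<subseteq> V" "y = face_dim F"
      using \<open>y \<in> _\<close> by blast
    then show ?thesis
      using card_mono[OF assms, of F] by (simp add: face_dim_def)
  qed
qed (use assms in \<open>auto simp: face_dim_def\<close>)

text \<open>
  A cycle is the boundary of its cone with apex the least vertex. The bound on \<open>i\<close> excludes the
  empty simplex in degree \<open>-1\<close>: it has no apex, and its empty face is a cycle that does not bound.
\<close>

lemma cycle_in_Pow_is_boundary:
  fixes V :: "'a::linorder set" and c :: "'a set \<Rightarrow>\<^sub>0 'k::field"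
  assumes "finite V" "i < int (card V) - 1" "c \<in> chains (Pow V) i" "boundary c = 0"
  shows "c \<in> boundary ` chains (Pow V) (i + 1)"
proof (cases "V = {}")
  case True
  then have "Poly_Mapping.keys c = {}"
    using assms(2,3) by (auto simp: chains_def face_dim_def)
  then have "c = 0"
    by simp
  then show ?thesis
    using zero_in_chains additive.zero[OF additive_boundary] by (metis imageI)
next
  case False
  let ?v = "Min V"
  have c: "F \<subseteq> V \<and> face_dim F = i" if "F \<in> Poly_Mapping.keys c" for F
    using that assms(3) by (auto simp: chains_def)
  have "finite F \<and> (\<forall>u \<in> F. ?v \<le> u)" if "F \<in> Poly_Mapping.keys c" for F
    using c[OF that] assms(1) by (meson Min_le finite_subset subsetD)
  then have "boundary (cone_chain ?v c) = c"
    by (simp add: boundary_cone_chain assms(4) additive.zero[OF additive_cone_chain])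
  moreover have "cone_chain ?v c \<in> chains (Pow V) (i + 1)"
  proof -
    have "E \<subseteq> V \<and> face_dim E = i + 1" if "E \<in> Poly_Mapping.keys (cone_chain ?v c)" for E
    proof -
      obtain F where F: "F \<in> Poly_Mapping.keys c" "?v \<notin> F" "E = insert ?v F"
        using \<open>E \<in> _\<close> by (rule keys_cone_chain)
      then have "F \<subseteq> V" "face_dim F = i" "finite F"
        using c finite_subset[OF _ assms(1)] by auto
      then show ?thesis
        using F assms(1) False by (simp add: face_dim_def)
    qed
    then show ?thesis
      by (auto simp: chains_def)
  qed
  ultimately show ?thesis
    by (metis imageI)
qed

lemma cohen_macaulay_Pow:
  fixes V :: "'a::linorder set"
  assumes "finite V"
  shows "cohen_macaulay TYPE('k::field) (Pow V)"
  unfolding cohen_macaulay_def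
proof (intro conjI ballI allI impI)
  fix F i assume "F \<in> Pow V" and i: "i < complex_dim (link (Pow V) F)"
  then have link: "link (Pow V) F = Pow (V - F)"
    by (simp add: link_Pow)
  show "trivial_group (reduced_homology (link (Pow V) F) i :: ('a set \<Rightarrow>\<^sub>0 'k) set monoid)"
    unfolding link
  proof (subst trivial_reduced_homology_iff)
    show "\<forall>c \<in> chains (Pow (V - F)) i. boundary c = (0 :: 'a set \<Rightarrow>\<^sub>0 'k) \<longrightarrow>
        c \<in> boundary ` chains (Pow (V - F)) (i + 1)"
      using i assms link by (auto simp: complex_dim_Pow intro!: cycle_in_Pow_is_boundary)
  qed auto
qed (rule pure_Pow)

text \<open>
  Deleting a point leaves fewer points, and the link of a point is the simplex \<open>{{}}\<close>.
\<close>

lemma vertex_decomposable_points: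
  assumes "finite V" "V \<noteq> {}"
  shows "vertex_decomposable (insert {} ((\<lambda>x. {x}) ` V))"
  using assms
proof (induction V rule: finite_ne_induct)
  case (singleton x)
  have "insert {} ((\<lambda>x. {x}) ` {x}) = Pow {x}"
    by auto
  then show ?case
    using vertex_decomposable.simplex[of "Pow {x}"] by (simp only: facets_Pow pure_Pow Union_Pow_eq)
next
  case (insert x V)
  let ?\<Delta> = "\<lambda>V. insert {} ((\<lambda>x. {x}) ` V) :: 'a set set"
  have "facets (?\<Delta> (insert x V)) = (\<lambda>x. {x}) ` insert x V"
    by (auto simp: facets_def)
  then have "pure_complex (?\<Delta> (insert x V))"
    by (auto simp: pure_complex_def face_dim_def)
  moreover have "link (?\<Delta> (insert x V)) {x} = Pow {}"
    by (auto simp: link_def)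
  moreover have "vertex_decomposable (Pow {} :: 'a set set)"
    using vertex_decomposable.simplex[of "Pow {} :: 'a set set"]
    by (simp only: facets_Pow pure_Pow Union_Pow_eq)
  moreover have "del (?\<Delta> (insert x V)) {x} = ?\<Delta> V"
    using insert.hyps by (auto simp: del_def)
  ultimately show ?case
    using insert.IH vertex_decomposable.vertex[of "?\<Delta> (insert x V)" x] by auto
qed


section \<open>Disjoint unions of simplices of equal dimension\<close>

text \<open>
  The blocks in \<open>Ps\<close> are the vertex sets of the simplices. They are the facets of the union, since
  disjoint nonempty sets are incomparable.
\<close>

locale disjoint_simplices =
  fixes Ps :: "'a::linorder set set" and m :: nat
  assumes finite_blocks: "finite Ps" and blocks_nonempty: "Ps \<noteq> {}"
    and disjoint: "\<And>P Q x. P \<in> Ps \<Longrightarrow> Q \<in> Ps \<Longrightarrow> x \<in> P \<Longrightarrow> x \<in> Q \<Longrightarrow> P = Q"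
    and card_block: "\<And>P. P \<in> Ps \<Longrightarrow> card P = m"
    and m_pos: "m \<ge> 1"
begin

abbreviation \<Delta> :: "'a set set" where
  "\<Delta> \<equiv> \<Union>(Pow ` Ps)"

lemma finite_block: "P \<in> Ps \<Longrightarrow> finite P"
  using card_block[of P] m_pos by (intro card_ge_0_finite) simp

lemma block_nonempty: "P \<in> Ps \<Longrightarrow> P \<noteq> {}"
  using card_block[of P] m_pos by auto

lemma finite_complex: "finite \<Delta>"
  by (intro finite_Union) (use finite_blocks finite_block in auto)

lemma block_of_face:
  assumes "P \<in> Ps" "F \<in> \<Delta>" "x \<in> F" "x \<in> P" shows "F \<subseteq> P"
proof -
  obtain Q where Q: "Q \<in> Ps" "F \<subseteq> Q"
    using assms(2) by blast
  then have "P = Q"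
    using assms(1,3,4) by (intro disjoint[of P Q x]) auto
  then show ?thesis
    using Q(2) by simp
qed

lemma facets_complex: "facets \<Delta> = Ps"
proof
  show "facets \<Delta> \<subseteq> Ps"
  proof
    fix F assume F: "F \<in> facets \<Delta>"
    then obtain P where P: "P \<in> Ps" "F \<subseteq> P"
      by (auto simp: facets_def)
    then have "P = F"
      using F by (auto simp: facets_def)
    then show "F \<in> Ps"
      using P by simp
  qed
  show "Ps \<subseteq> facets \<Delta>"
  proof
    fix P assume P: "P \<in> Ps"
    then obtain x where "x \<in> P"
      using block_nonempty by blast
    then have "H \<subseteq> P" if "H \<in> \<Delta>" "P \<subseteq> H" for H
      using block_of_face[OF P] that by blast
    then show "P \<in> facets \<Delta>"
      using P by (auto simp: facets_def)
  qed
qed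

lemma pure_complex: "pure_complex \<Delta>"
  by (simp add: pure_complex_def facets_complex face_dim_def card_block)

lemma link_face:
  assumes "P \<in> Ps" "F \<subseteq> P" "F \<noteq> {}"
  shows "link \<Delta> F = Pow (P - F)"
proof -
  have sub: "F \<union> H \<subseteq> P" if "F \<union> H \<in> \<Delta>" for H
  proof -
    obtain x where "x \<in> F"
      using assms(3) by blast
    then show ?thesis
      using block_of_face[OF assms(1) that, of x] assms(2) by blast
  qed
  have "H \<in> link \<Delta> F \<longleftrightarrow> H \<subseteq> P - F" for H
  proof
    assume "H \<in> link \<Delta> F"
    then have "F \<inter> H = {}" "F \<union> H \<subseteq> P"
      using sub[of H] unfolding link_def by blast+
    then show "H \<subseteq> P - F"
      by blast
  next
    assume H: "H \<subseteq> P - F"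
    then have "H \<subseteq> P" "F \<union> H \<subseteq> P" "F \<inter> H = {}"
      using assms(2) by auto
    then show "H \<in> link \<Delta> F"
      using assms(1) unfolding link_def by blast
  qed
  then show ?thesis
    by blast
qed

lemma buchsbaum: "buchsbaum TYPE('k::field) \<Delta>"
  unfolding buchsbaum_def
proof (intro conjI allI impI)
  fix x assume "{x} \<in> \<Delta>"
  then obtain P where "P \<in> Ps" "x \<in> P"
    by auto
  then show "cohen_macaulay TYPE('k) (link \<Delta> {x})"
    using finite_block by (subst link_face) (auto intro: cohen_macaulay_Pow)
qed (rule pure_complex)

lemma complex_dim: "complex_dim \<Delta> = int m - 1"
  unfolding complex_dim_def
proof (rule Max_eqI)
  show "finite (face_dim ` \<Delta>)"
    using finite_complex by blast
  show "y \<le> int m - 1" if "y \<in> face_dim ` \<Delta>" for y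
  proof -
    obtain P F where P: "P \<in> Ps" "F \<subseteq> P" "y = face_dim F"
      using \<open>y \<in> _\<close> by blast
    then have "card F \<le> m"
      using card_mono[OF finite_block] card_block by metis
    then show ?thesis
      using P by (simp add: face_dim_def)
  qed
  obtain P where "P \<in> Ps"
    using blocks_nonempty by blast
  then show "int m - 1 \<in> face_dim ` \<Delta>"
    using card_block by (intro image_eqI[of _ _ P]) (auto simp: face_dim_def)
qed

lemma link_empty: "link \<Delta> {} = \<Delta>"
  by (auto simp: link_def)

subsection \<open>Points\<close>

lemma shellable_points:
  assumes "m = 1" shows "shellable \<Delta>"
proof -
  obtain Fs where Fs: "set Fs = Ps" "distinct Fs"
    using finite_distinct_list[OF finite_blocks] by blast
  have "\<exists>x \<in> Fs ! i - Fs ! j. \<exists>l < i. Fs ! i - Fs ! l = {x}" if "i < length Fs" "j < i" for i j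
  proof -
    have blocks: "Fs ! i \<in> Ps" "Fs ! j \<in> Ps" "Fs ! i \<noteq> Fs ! j"
      using that Fs by (auto simp: nth_eq_iff_index_eq)
    then obtain x where "Fs ! i = {x}"
      using card_block assms by (metis card_1_singletonE)
    moreover from this have "x \<notin> Fs ! j"
      using blocks disjoint by blast
    ultimately show ?thesis
      using that(2) by auto
  qed
  then show ?thesis
    using Fs pure_complex facets_complex by (auto simp: shellable_def)
qed

text \<open>
  Only the link of the empty face, the complex itself, needs thought. In negative degrees its
  chains live on the empty face and hence in any one of the simplices, where cycles bound.
\<close>

lemma cohen_macaulay_points:
  assumes "m = 1" shows "cohen_macaulay TYPE('k::field) \<Delta>"
  unfolding cohen_macaulay_def
proof (intro conjI ballI allI impI)
  fix F i assume F: "F \<in> \<Delta>" and i: "i < complex_dim (link \<Delta> F)"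
  show "trivial_group (reduced_homology (link \<Delta> F) i :: ('a set \<Rightarrow>\<^sub>0 'k) set monoid)"
  proof (cases "F = {}")
    case False
    then obtain P where P: "P \<in> Ps" "F \<subseteq> P"
      using F by blast
    have "cohen_macaulay TYPE('k) (Pow P)"
      using P finite_block cohen_macaulay_Pow by blast
    then show ?thesis
      using i P False by (simp add: cohen_macaulay_def link_face link_Pow)
  next
    case True
    obtain P where P: "P \<in> Ps"
      using blocks_nonempty by blast
    have i: "i < 0"
      using i True complex_dim assms by (simp add: link_empty)
    have "c \<in> boundary ` chains \<Delta> (i + 1)"
      if c: "c \<in> chains \<Delta> i" "boundary c = 0" for c :: "'a set \<Rightarrow>\<^sub>0 'k"
    proof -
      have "F = {}" if "F \<in> Poly_Mapping.keys c" for F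
      proof -
        have "F \<in> \<Delta>" "int (card F) - 1 = i"
          using that c(1) by (auto simp: chains_def face_dim_def)
        moreover have "finite F"
          using \<open>F \<in> \<Delta>\<close> finite_block finite_subset by blast
        ultimately show ?thesis
          using i by (cases "card F") simp_all
      qed
      then have "c \<in> chains (Pow P) i"
        using c(1) by (auto simp: chains_def)
      then have "c \<in> boundary ` chains (Pow P) (i + 1)"
        using c(2) i P finite_block card_block assms by (intro cycle_in_Pow_is_boundary) auto
      moreover have "chains (Pow P) (i + 1) \<subseteq> chains \<Delta> (i + 1)"
        using P by (auto simp: chains_def)
      ultimately show ?thesis
        by blast
    qed
    then show ?thesis
      using True by (subst trivial_reduced_homology_iff) (auto simp: link_empty)
  qed
qed (rule pure_complex)

subsection \<open>Several simplices of positive dimension\<close>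

text \<open>
  The shelling condition for the second facet can only be met by the first facet, which is
  disjoint from it.
\<close>

lemma not_shellable:
  assumes "m \<ge> 2" "card Ps \<ge> 2" shows "\<not> shellable \<Delta>"
proof
  assume "shellable \<Delta>"
  then obtain Fs where Fs: "distinct Fs" "set Fs = Ps" and
    "\<forall>i < length Fs. \<forall>j < i. \<exists>x \<in> Fs ! i - Fs ! j. \<exists>l < i. Fs ! i - Fs ! l = {x}"
    by (auto simp: shellable_def facets_complex)
  moreover have len: "length Fs \<ge> 2"
    using Fs assms(2) distinct_card by fastforce
  ultimately have "\<exists>x \<in> Fs ! 1 - Fs ! 0. \<exists>l < 1. Fs ! 1 - Fs ! l = {x}"
    by (metis less_le_trans one_less_numeral_iff semiring_norm(76) zero_less_one)
  then obtain x where x: "Fs ! 1 - Fs ! 0 = {x}"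
    by auto
  have "0 < length Fs" "1 < length Fs"
    using len by linarith+
  then have "Fs ! 0 \<noteq> Fs ! 1" "Fs ! 0 \<in> Ps" "Fs ! 1 \<in> Ps"
    using Fs nth_eq_iff_index_eq[OF Fs(1), of 0 1] nth_mem[of 0 Fs] nth_mem[of 1 Fs] by auto
  then have "Fs ! 1 - Fs ! 0 = Fs ! 1"
    using disjoint by blast
  then show False
    using x card_block[OF \<open>Fs ! 1 \<in> Ps\<close>] assms(1) by simp
qed

lemma two_blocks:
  assumes "card Ps \<ge> 2" "P \<in> Ps" obtains Q where "Q \<in> Ps" "Q \<noteq> P"
proof -
  have "Ps \<noteq> {P}"
    using assms(1) by auto
  then show ?thesis
    using that assms(2) by blast
qed

text \<open>
  Two blocks do not form a simplex, and no vertex can be the first one deleted: the block that loses it stays a facet of the deletion,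
  as \<open>m \<ge> 2\<close> leaves it nonempty, but is smaller than the other blocks.
\<close>

lemma not_vertex_decomposable:
  assumes "m \<ge> 2" "card Ps \<ge> 2" shows "\<not> vertex_decomposable \<Delta>"
proof
  assume "vertex_decomposable \<Delta>"
  then show False
  proof cases
    case simplex
    then have "card Ps = 1"
      unfolding facets_complex by (metis card_1_singleton_iff One_nat_def)
    then show False
      using assms(2) by simp
  next
    case (vertex x)
    then obtain P where P: "P \<in> Ps" "x \<in> P"
      by auto
    obtain Q where Q: "Q \<in> Ps" "Q \<noteq> P"
      using two_blocks[OF assms(2) P(1)] .
    have xQ: "x \<notin> Q"
      using P Q disjoint by blast
    have "pure_complex (del \<Delta> {x})"
      using vertex(4) by cases
    moreover have "P - {x} \<in> facets (del \<Delta> {x})"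
    proof -
      have "card (P - {x}) \<noteq> 0"
        using P card_block assms(1) by simp
      then have "P - {x} \<noteq> {}"
        by (metis card.empty)
      then obtain y where y: "y \<in> P - {x}"
        by blast
      have "H = P - {x}" if H: "H \<in> del \<Delta> {x}" "P - {x} \<subseteq> H" for H
      proof -
        have "H \<in> \<Delta>" "x \<notin> H"
          using H(1) unfolding del_def by blast+
        then have "H \<subseteq> P"
          using block_of_face[OF P(1), of H y] y H(2) by blast
        then show ?thesis
          using H(2) \<open>x \<notin> H\<close> by blast
      qed
      moreover have "P - {x} \<in> del \<Delta> {x}"
        using P(1) unfolding del_def by blast
      ultimately show ?thesis
        unfolding facets_def by blast
    qed
    moreover have "Q \<in> facets (del \<Delta> {x})"
    proof -
      have "Q \<in> facets \<Delta>"
        using Q(1) facets_complex by simp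
      then show ?thesis
        using xQ unfolding facets_def del_def by blast
    qed
    ultimately have "face_dim (P - {x}) = face_dim Q"
      unfolding pure_complex_def by blast
    then have "card (P - {x}) = card Q"
      by (simp add: face_dim_def)
    then show False
      using P Q card_block assms(1) by simp
  qed
qed

text \<open>
  The difference of two points in different blocks is a cycle in degree \<open>0\<close>. It does not bound,
  because the sum of the coefficients over the points of one block is an additive functional that
  vanishes on boundaries of edges, whose ends lie in the same block, but is \<open>1\<close> on the difference.
\<close>

lemma not_cohen_macaulay:
  assumes "m \<ge> 2" "card Ps \<ge> 2" shows "\<not> cohen_macaulay TYPE('k::field) \<Delta>"
proof
  assume CM: "cohen_macaulay TYPE('k) \<Delta>"
  obtain P where P: "P \<in> Ps"
    using blocks_nonempty by blast
  obtain Q where Q: "Q \<in> Ps" "Q \<noteq> P"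
    using two_blocks[OF assms(2) P] .
  obtain x y where xy: "x \<in> P" "y \<in> Q"
    using P Q block_nonempty by blast
  have y: "y \<notin> P"
    using P Q xy disjoint by blast
  let ?c = "Poly_Mapping.single {x} 1 - Poly_Mapping.single {y} 1 :: 'a set \<Rightarrow>\<^sub>0 'k"
  let ?\<epsilon> = "\<lambda>c :: 'a set \<Rightarrow>\<^sub>0 'k. \<Sum>z \<in> P. Poly_Mapping.lookup c {z}"
  have \<epsilon>: "additive ?\<epsilon>"
    by (simp add: additive_def lookup_add sum.distrib)
  have \<epsilon>_single: "?\<epsilon> (Poly_Mapping.single {z} a) = (if z \<in> P then a else 0)" for z a
    using finite_block[OF P] by (simp add: lookup_single when_def)
  have "trivial_group (reduced_homology \<Delta> 0 :: ('a set \<Rightarrow>\<^sub>0 'k) set monoid)"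
  proof -
    have "{} \<in> \<Delta>" "0 < complex_dim (link \<Delta> {})"
      using P assms(1) by (auto simp: link_empty complex_dim)
    then have "trivial_group (reduced_homology (link \<Delta> {}) 0 :: ('a set \<Rightarrow>\<^sub>0 'k) set monoid)"
      using CM unfolding cohen_macaulay_def by blast
    then show ?thesis
      by (simp only: link_empty)
  qed
  moreover have "?c \<in> chains \<Delta> 0"
    using P Q xy by (auto simp: chains_def face_dim_def dest!: subsetD[OF keys_diff])
  moreover have "boundary ?c = 0"
    by (simp add: additive.diff[OF additive_boundary] boundary_vertex)
  ultimately obtain d where d: "d \<in> chains \<Delta> 1" "?c = boundary d"
    by (subst (asm) trivial_reduced_homology_iff) auto
  have "?\<epsilon> (boundary d) = 0"
  proof (rule additive_eq_zeroI[OF additive_comp[OF \<epsilon> additive_boundary]])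
    fix F and a :: 'k assume "F \<in> Poly_Mapping.keys d"
    then have F: "F \<in> \<Delta>" "card F = 2"
      using d(1) by (auto simp: chains_def face_dim_def)
    then obtain u w where uw: "F = {u, w}" "u < w"
      by (metis card_2_iff insert_commute linorder_neqE)
    have "u \<in> P \<longleftrightarrow> w \<in> P"
      using F(1) uw(1) block_of_face[OF P F(1)] by auto
    moreover have "boundary (Poly_Mapping.single F a) =
        Poly_Mapping.single {w} a - Poly_Mapping.single {u} a"
      using boundary_cone_single[of "{w}" u a] uw
      by (simp add: boundary_vertex cone_chain_single)
    ultimately show "?\<epsilon> (boundary (Poly_Mapping.single F a)) = 0"
      by (simp only: additive.diff[OF \<epsilon>] \<epsilon>_single) simp
  qed
  moreover have "?\<epsilon> ?c = 1"
    using xy y by (simp only: additive.diff[OF \<epsilon>] \<epsilon>_single) simp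
  ultimately show False
    using d(2) by simp
qed

end


section \<open>Independent sets of the one-paired circulant\<close>

definition residue_class :: "nat \<Rightarrow> nat \<Rightarrow> nat \<Rightarrow> nat set" where
  "residue_class n b r = {x. x < n \<and> x mod b = r}"

text \<open>
  Restricting distances to at most \<open>n div 2\<close> loses nothing: one of \<open>d\<close> and \<open>n - d\<close> is in that
  range, and divisibility by \<open>b\<close> does not distinguish them when \<open>b\<close> divides \<open>n\<close>.
\<close>

lemma circulant_edge_iff:
  assumes "b dvd n" "x < n" "y < n"
  shows "{x, y} \<in> edges (one_paired_circulant n 1 b) \<longleftrightarrow> x mod b \<noteq> y mod b"
proof -
  let ?S = "{d \<in> {1..n div 2}. 1 dvd d \<and> \<not> 1 * b dvd d}"
  let ?A = "\<lambda>x y. x \<noteq> y \<and> (nat \<bar>int x - int y\<bar> \<in> ?S \<or> n - nat \<bar>int x - int y\<bar> \<in> ?S)"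
  have A: "?A x y \<longleftrightarrow> x mod b \<noteq> y mod b" if "x < n" "y < n" for x y
  proof -
    let ?d = "nat \<bar>int x - int y\<bar>"
    have d: "?d < n" and "n - ?d \<le> n"
      using that by auto
    have "b dvd ?d \<longleftrightarrow> int b dvd int x - int y"
      by (metis dvd_abs_iff int_dvd_int_iff int_nat_eq abs_ge_zero)
    also have "\<dots> \<longleftrightarrow> x mod b = y mod b"
      by (metis mod_eq_dvd_iff of_nat_eq_iff zmod_int)
    finally have dvd: "b dvd ?d \<longleftrightarrow> x mod b = y mod b" .
    have dvd': "b dvd n - ?d \<longleftrightarrow> b dvd ?d"
      using assms(1) d by (metis dvd_diff_nat diff_diff_cancel less_imp_le)
    have "?d \<le> n div 2 \<or> n - ?d \<le> n div 2"
      by linarith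
    moreover have "1 \<le> n - ?d"
      using d by linarith
    moreover have "1 \<le> ?d \<longleftrightarrow> x \<noteq> y"
      by linarith
    ultimately show ?thesis
      using dvd dvd' by auto
  qed
  have "{x, y} \<in> edges (one_paired_circulant n 1 b) \<longleftrightarrow>
      (\<exists>x' y'. {x, y} = {x', y'} \<and> x' < n \<and> y' < n \<and> ?A x' y')"
    by (simp add: one_paired_circulant_def circulant_def)
  also have "\<dots> \<longleftrightarrow> (\<exists>x' y'. {x, y} = {x', y'} \<and> x' < n \<and> y' < n \<and> x' mod b \<noteq> y' mod b)"
    using A by blast
  also have "\<dots> \<longleftrightarrow> x mod b \<noteq> y mod b"
    using assms by (auto simp: doubleton_eq_iff)
  finally show ?thesis .
qed

lemma Ind_one_paired_circulant:
  assumes "b \<ge> 1"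
  shows "Ind (one_paired_circulant (m * b) 1 b) =
    \<Union>(Pow ` (residue_class (m * b) b ` {..<b}))"
proof -
  let ?G = "one_paired_circulant (m * b) 1 b"
  have verts: "verts ?G = {0..<m * b}"
    by (simp add: one_paired_circulant_def circulant_def)
  have edge: "{x, y} \<in> edges ?G \<longleftrightarrow> x mod b \<noteq> y mod b" if "x < m * b" "y < m * b" for x y
    using that by (intro circulant_edge_iff) auto
  have edgeE: "\<exists>x y. e = {x, y} \<and> x < m * b \<and> y < m * b" if "e \<in> edges ?G" for e
    using that by (auto simp: one_paired_circulant_def circulant_def)
  have "W \<in> Ind ?G \<longleftrightarrow> (\<exists>r < b. W \<subseteq> residue_class (m * b) b r)" for W
  proof
    assume W: "W \<in> Ind ?G"
    then have lt: "x < m * b" if "x \<in> W" for x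
      using W that verts unfolding Ind_def by auto
    show "\<exists>r < b. W \<subseteq> residue_class (m * b) b r"
    proof (cases "W = {}")
      case True
      then show ?thesis
        using assms by (intro exI[of _ 0]) auto
    next
      case False
      then obtain x where x: "x \<in> W"
        by blast
      have "y mod b = x mod b" if "y \<in> W" for y
        using W that x edge[OF lt lt, of y x] by (fastforce simp: Ind_def)
      then show ?thesis
        using lt assms by (intro exI[of _ "x mod b"]) (auto simp: residue_class_def)
    qed
  next
    assume "\<exists>r < b. W \<subseteq> residue_class (m * b) b r"
    then obtain r where r: "W \<subseteq> residue_class (m * b) b r"
      by blast
    have "\<not> e \<subseteq> W" if "e \<in> edges ?G" for e
    proof
      assume "e \<subseteq> W"
      moreover obtain x y where "e = {x, y}" "x < m * b" "y < m * b"
        using edgeE[OF \<open>e \<in> edges ?G\<close>] by blast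
      ultimately have "x mod b \<noteq> y mod b" "x \<in> residue_class (m * b) b r" "y \<in> residue_class (m * b) b r"
        using \<open>e \<in> edges ?G\<close> edge r by blast+
      then show False
        by (simp add: residue_class_def)
    qed
    moreover have "W \<subseteq> verts ?G"
      using r unfolding verts by (auto simp: residue_class_def)
    ultimately show "W \<in> Ind ?G"
      by (auto simp: Ind_def)
  qed
  then show ?thesis
    by auto
qed

lemma card_residue_class:
  assumes "r < b" shows "card (residue_class (m * b) b r) = m"
proof -
  have "residue_class (m * b) b r = (\<lambda>q. q * b + r) ` {..<m}"
  proof (intro equalityI subsetI)
    fix x assume "x \<in> residue_class (m * b) b r"
    then have "x = (x div b) * b + r" "x div b < m"
      by (auto simp: residue_class_def less_mult_imp_div_less)
    then show "x \<in> (\<lambda>q. q * b + r) ` {..<m}"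
      by blast
  next
    fix x assume "x \<in> (\<lambda>q. q * b + r) ` {..<m}"
    then obtain q where q: "x = q * b + r" "q < m"
      by blast
    then have "Suc q * b \<le> m * b"
      by (intro mult_le_mono1) simp
    then show "x \<in> residue_class (m * b) b r"
      using q assms by (auto simp: residue_class_def)
  qed
  moreover have "inj_on (\<lambda>q. q * b + r) {..<m}"
    using assms by (auto simp: inj_on_def)
  ultimately show ?thesis
    by (simp add: card_image)
qed

lemma residue_class_one: "r < b \<Longrightarrow> residue_class (1 * b) b r = {r}"
  by (auto simp: residue_class_def)

theorem theorem5p9:
  fixes m b :: nat and G :: "nat simple_graph"
  assumes "m \<ge> 1" and "b \<ge> 1"
    and "G = one_paired_circulant (m * b) 1 b"
  shows "buchsbaum TYPE('k::field) (Ind G) \<and>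
    (b \<ge> 2 \<longrightarrow>
      (vertex_decomposable (Ind G) \<longleftrightarrow> m = 1) \<and>
      (shellable (Ind G) \<longleftrightarrow> m = 1) \<and>
      (cohen_macaulay TYPE('k) (Ind G) \<longleftrightarrow> m = 1))"
proof -
  let ?Ps = "residue_class (m * b) b ` {..<b}"
  have card: "card P = m" if "P \<in> ?Ps" for P
    using that card_residue_class by blast
  interpret disjoint_simplices ?Ps m
    using assms(1,2) card by unfold_locales (auto simp: residue_class_def lessThan_empty_iff bot_nat_def)
  have Ind: "Ind G = \<Union>(Pow ` ?Ps)"
    using assms Ind_one_paired_circulant by blast
  have "inj_on (residue_class (m * b) b) {..<b}"
  proof (rule inj_onI)
    fix r s assume rs: "r \<in> {..<b}" "s \<in> {..<b}"
      "residue_class (m * b) b r = residue_class (m * b) b s"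
    then have "residue_class (m * b) b r \<noteq> {}"
      by (intro block_nonempty) simp
    then show "r = s"
      using rs(3) by (auto simp: residue_class_def)
  qed
  then have blocks: "card ?Ps = b"
    by (simp add: card_image)
  have "vertex_decomposable (Ind G)" if "m = 1"
  proof -
    have "Ind G = insert {} ((\<lambda>x. {x}) ` {..<b})"
    proof -
      have "?Ps = (\<lambda>x. {x}) ` {..<b}"
        using residue_class_one \<open>m = 1\<close> by (intro image_cong) auto
      moreover have "0 \<in> {..<b}"
        using assms(2) by simp
      ultimately show ?thesis
        unfolding Ind by (auto simp only: subset_singleton_iff)
    qed
    then show ?thesis
      using assms(2) vertex_decomposable_points[of "{..<b}"] by (simp add: lessThan_empty_iff bot_nat_def)
  qed
  moreover have "\<not> vertex_decomposable (Ind G) \<and> \<not> shellable (Ind G) \<and>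
      \<not> cohen_macaulay TYPE('k) (Ind G)" if "b \<ge> 2" "m \<noteq> 1"
    unfolding Ind using that assms(1) blocks
    by (intro conjI not_vertex_decomposable not_shellable not_cohen_macaulay) auto
  moreover have "shellable (Ind G)" "cohen_macaulay TYPE('k) (Ind G)" if "m = 1"
    unfolding Ind by (rule shellable_points[OF that] cohen_macaulay_points[OF that])+
  moreover have "buchsbaum TYPE('k) (Ind G)"
    unfolding Ind by (rule buchsbaum)
  ultimately show ?thesis
    by blast
qed

end
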